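(* Consider $N$ agents with dynamics $x_i^{t+1}=A_ix_i^t+B_iu_i^t+w_i^t$, $w_i^t\in\mathcal{W}_i$, in closed loop with the robust receding horizon game controller described in the context. Let $\mathcal{D}(x^t)$ be the joint feasible set of the receding horizon game at time $t$, $z^{*,t}$ its vGNE at time $t$, with first nominal state and input $s_i^{*,0|t},v_i^{*,0|t}$ for agent $i$, and let $V(z)=\sum_{i=1}^NJ_i(z_i)$. Suppose $\mathcal{D}(x^0)\ne\emptyset$. Then for every realization $w_i^t\in\mathcal{W}_i$, $i\in\mathcal{A}$, $t\ge0$, of the disturbances, the following hold. (i) (Lyapunov decrease.) For all $t\ge0$, $$V(z^{*,t+1})-V(z^{*,t})\le-\sum_{i=1}^Nl_i^p(s_i^{*,0|t},v_i^{*,0|t}).$$ (ii) (Nominal convergence.) For every $i\in\mathcal{A}$, $\lim_{t\to\infty}\|s_i^{*,0|t}-s_i^*\|=0$ and $\lim_{t\to\infty}\|v_i^{*,0|t}-v_i^*\|=0$. (iii) (Actual-state convergence.) For every $i\in\mathcal{A}$, the actual state $x_i^t$ converges to the set $\{s_i^*\}\oplus\mathcal{Z}_i^\infty$: $$\mathrm{dist}\big(x_i^t,\{s_i^*\}\oplus\mathcal{Z}_i^\infty\big)\le\|s_i^{*,0|t}-s_i^*\|\to0\quad\text{as }t\to\infty.$$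
   Context: Agents and graph. $\mathcal{A}=\{1,\dots,N\}$ is the set of agents, the nodes of a connected undirected graph; $\mathcal{N}_i\subseteq\mathcal{A}$ is the set of neighbors of $i$, including $i$ itself. Agent $i$ has state $x_i^t\in\mathbb{R}^{n_x}$, input $u_i^t\in\mathbb{R}^{n_u}$ and dynamics $x_i^{t+1}=A_ix_i^t+B_iu_i^t+w_i^t$ with $w_i^t\in\mathcal{W}_i$; $x^t=\mathrm{col}(x_i^t)_{i\in\mathcal{A}}$. Data: private constraint sets $\mathcal{X}_i\subset\mathbb{R}^{n_x}$, $\mathcal{U}_i\subset\mathbb{R}^{n_u}$; matrices $F_i\in\mathbb{R}^{n_c\times n_x}$, $G_i\in\mathbb{R}^{n_c\times n_u}$ and vectors $b_i\in\mathbb{R}^{n_c}$ of the shared constraints $\sum_{j\in\mathcal{N}_i}(F_jx_j+G_ju_j)\le b_i$; weights $Q_i,R_i$. All vector inequalities and minima are componentwise; $\|\cdot\|$ is the Euclidean norm and $\mathrm{dist}$ the associated point-to-set distance; $\|x\|_Q^2:=x^\top Qx$; $\oplus$ and $\ominus$ are Minkowski sum and Pontryagin difference. Standing assumptions. For each $i$: $\mathcal{W}_i$ is compact and convex with $0\in\mathrm{int}(\mathcal{W}_i)$; $\mathcal{X}_i,\mathcal{U}_i$ are nonempty, compact and convex; $(A_i,B_i)$ is stabilizable; $Q_i,R_i$ are symmetric positive definite. Tightening. $K_i^p$ is a gain such that $\Phi_i^p:=A_i+B_iK_i^p$ is Schur stable. $\mathcal{Z}_i^\infty:=\bigoplus_{n=0}^\infty(\Phi_i^p)^n\mathcal{W}_i$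 is the minimal robust positively invariant set: it is compact and $\Phi_i^pe+w\in\mathcal{Z}_i^\infty$ for all $e\in\mathcal{Z}_i^\infty$, $w\in\mathcal{W}_i$. Put $\mathcal{S}_i:=\mathcal{X}_i\ominus\mathcal{Z}_i^\infty$, $\mathcal{V}_i:=\mathcal{U}_i\ominus K_i^p\mathcal{Z}_i^\infty$. With $c_{j,\ell}^\top$ the $\ell$-th row of $F_j+G_jK_j^p$, let $d_j\in\mathbb{R}^{n_c}$, $[d_j]_\ell:=\max_{e\in\mathcal{Z}_j^\infty}c_{j,\ell}^\top e$, and $\bar b_i:=b_i-\sum_{j\in\mathcal{N}_i}d_j$. Steady-state vGNE. For each $i$, $\tilde l_i^p:\mathbb{R}^{n_x}\times\mathbb{R}^{n_u}\to\mathbb{R}$ is continuously differentiable and strongly convex. Let $\mathcal{Z}$ be the set of $z=\mathrm{col}(s_i,v_i)_{i\in\mathcal{A}}$ such that for all $i$: $s_i=A_is_i+B_iv_i$, $s_i\in\mathcal{S}_i$, $v_i\in\mathcal{V}_i$, $\sum_{j\in\mathcal{N}_i}(F_js_j+G_jv_j)\le\bar b_i$. $\mathcal{Z}$ is assumed nonempty. The steady-state vGNE $z^*=\mathrm{col}(s_i^*,v_i^* )_i\in\mathcal{Z}$ is the (unique) solution of the variational inequality $\mathrm{col}(\nabla\tilde l_i^p(s_i^*,v_i^* ))_i^\top(z-z^* )\ge0$ for all $z\in\mathcal{Z}$. Terminal ingredients. $P_i\succ0$ is the unique stabilizing solution of $P_i=Q_i+A_i^\top P_iA_i-A_i^\top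 P_iB_i(R_i+B_i^\top P_iB_i)^{-1}B_i^\top P_iA_i$; $K_i^f:=-(R_i+B_i^\top P_iB_i)^{-1}B_i^\top P_iA_i$; $\kappa_i(s_i):=v_i^*+K_i^f(s_i-s_i^* )$; $l_i^f(s_i):=\|s_i-s_i^*\|_{P_i}^2$. Shares: for $j\in\mathcal{N}_i$, $\alpha_j^{(i)}:=F_js_j^*+G_jv_j^*+\frac{1}{|\mathcal{N}_i|}\big[\bar b_i-\sum_{k\in\mathcal{N}_i}(F_ks_k^*+G_kv_k^* )\big]$; $\mathcal{M}_j:=\{i\in\mathcal{A}:j\in\mathcal{N}_i\}$; $\alpha_j:=\min_{i\in\mathcal{M}_j}\alpha_j^{(i)}$. The terminal set $\mathcal{S}_i^f$ is the largest set $\mathcal{S}_i^f\subseteq\mathcal{S}_i$ such that every $s_i\in\mathcal{S}_i^f$ satisfies $\kappa_i(s_i)\in\mathcal{V}_i$, $F_is_i+G_i\kappa_i(s_i)\le\alpha_i$ and $A_is_i+B_i\kappa_i(s_i)\in\mathcal{S}_i^f$. Receding horizon game. $H\ge1$ is the horizon. Let $z_i^t=(s_i^{0|t},\dots,s_i^{H|t},v_i^{0|t},\dots,v_i^{H-1|t})$ and $z^t=\mathrm{col}(z_i^t)_i$. Agent $i$ minimizes $J_i(z_i^t):=\sum_{k=0}^{H-1}l_i^p(s_i^{k|t},v_i^{k|t})+l_i^f(s_i^{H|t})$, where $l_i^p(s_i,v_i):=\|s_i-s_i^*\|_{Q_i}^2+\|v_i-v_i^*\|_{R_i}^2$. The joint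 feasible set $\mathcal{D}(x^t)$ is the set of all $z^t$ such that for all $i\in\mathcal{A}$ and $k=0,\dots,H-1$: $s_i^{k+1|t}=A_is_i^{k|t}+B_iv_i^{k|t}$; $s_i^{k|t}\in\mathcal{S}_i$, $v_i^{k|t}\in\mathcal{V}_i$; $\sum_{j\in\mathcal{N}_i}(F_js_j^{k|t}+G_jv_j^{k|t})\le\bar b_i$; and moreover $s_i^{H|t}\in\mathcal{S}_i^f$ and $x_i^t-s_i^{0|t}\in\mathcal{Z}_i^\infty$. Closed loop. When $\mathcal{D}(x^t)\ne\emptyset$, $z^{*,t}=(s_i^{*,0|t},\dots,s_i^{*,H|t},v_i^{*,0|t},\dots,v_i^{*,H-1|t})_{i\in\mathcal{A}}\in\mathcal{D}(x^t)$ denotes the vGNE at time $t$, i.e. the (unique) solution of $\mathrm{col}(\nabla J_i(z_i^{*,t}))_i^\top(z-z^{*,t})\ge0$ for all $z\in\mathcal{D}(x^t)$. Each agent then applies $u_i^t=v_i^{*,0|t}+K_i^p(x_i^t-s_i^{*,0|t})$, and $x_i^{t+1}=A_ix_i^t+B_iu_i^t+w_i^t$. If $\mathcal{D}(x^0)\neq\emptyset$ then $\mathcal{D}(x^t)\neq\emptyset$ for all $t\ge0$ under every disturbance realization (recursive feasibility), so the closed-loop sequences $x^t$ and $z^{*,t}$ are defined for all $t\ge0$. *)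

theory Defs
  imports "HOL-Analysis.Analysis"
begin

section \<open>Generic notions\<close>

definition gradient :: "('a::real_inner \<Rightarrow> real) \<Rightarrow> 'a \<Rightarrow> 'a" where
  "gradient f x = (THE D. GDERIV f x :> D)"

lemma gradient_eqI:
  assumes "GDERIV f x :> D"
  shows "gradient f x = D"
  unfolding gradient_def
proof (rule the_equality)
  fix D' assume "GDERIV f x :> D'"
  then have "(\<lambda>h. inner h D') = (\<lambda>h. inner h D)"
    using assms has_derivative_unique unfolding gderiv_def by blast
  then have "inner (D' - D) D' = inner (D' - D) D" by (rule fun_cong)
  then have "inner (D' - D) (D' - D) = 0" by (simp add: inner_diff_right)
  then show "D' = D" by simp
qed (rule assms)

definition continuously_differentiable :: "('a::real_inner \<Rightarrow> real) \<Rightarrow> bool" where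
  "continuously_differentiable f \<longleftrightarrow>
     (\<exists>g. (\<forall>x. GDERIV f x :> g x) \<and> continuous_on UNIV g)"

definition strongly_convex :: "('a::real_inner \<Rightarrow> real) \<Rightarrow> bool" where
  "strongly_convex f \<longleftrightarrow>
     (\<exists>\<mu>>0. \<forall>x y. \<forall>\<theta>\<in>{0..1}.
        f ((1 - \<theta>) *\<^sub>R x + \<theta> *\<^sub>R y)
          \<le> (1 - \<theta>) * f x + \<theta> * f y - \<mu> / 2 * \<theta> * (1 - \<theta>) * (norm (x - y))\<^sup>2)"

definition sym_pos_def :: "real^'n^'n \<Rightarrow> bool" where
  "sym_pos_def M \<longleftrightarrow> transpose M = M \<and> (\<forall>x. x \<noteq> 0 \<longrightarrow> 0 < inner x (M *v x))"

text \<open>All complex eigenvalues lie in the open unit disc.\<close>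
definition schur_stable :: "real^'n^'n \<Rightarrow> bool" where
  "schur_stable M \<longleftrightarrow>
     (\<forall>(z::complex) (v::complex^'n).
        v \<noteq> 0 \<and> map_matrix complex_of_real M *v v = z *s v \<longrightarrow> cmod z < 1)"

definition stabilizable :: "real^'n^'n \<Rightarrow> real^'m^'n \<Rightarrow> bool" where
  "stabilizable A B \<longleftrightarrow> (\<exists>K::real^'n^'m. schur_stable (A + B ** K))"

definition wnorm2 :: "real^'n^'n \<Rightarrow> real^'n \<Rightarrow> real" where
  "wnorm2 M x = inner x (M *v x)"

definition pontryagin_diff :: "'a::ab_group_add set \<Rightarrow> 'a set \<Rightarrow> 'a set" (infixl \<open>\<ominus>\<^sub>P\<close> 65) where
  "X \<ominus>\<^sub>P Z = {x. \<forall>e\<in>Z. x + e \<in> X}"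

text \<open>
  The infinite Minkowski sum of the sets \<open>M\<^sup>n W\<close>: all sums of convergent series whose
  \<open>n\<close>-th term lies in \<open>M\<^sup>n W\<close>.  Multiplication on \<open>vec\<close> is componentwise, so
  the matrix power is written as iteration of the linear map.
\<close>
definition minkowski_series :: "real^'n^'n \<Rightarrow> (real^'n) set \<Rightarrow> (real^'n) set" where
  "minkowski_series M W =
     {e. \<exists>\<omega>. (\<forall>n. \<omega> n \<in> W) \<and> (\<lambda>n. (((*v) M) ^^ n) (\<omega> n)) sums e}"


section \<open>Data of the game\<close>

text \<open>
  The type parameters index, in this order, the agents and the coordinates of the local states,
  the local inputs and the shared constraints.
\<close>
record ('i, 'n, 'm, 'c) rhg =
  edges :: "('i \<times> 'i) set"
  mA :: "'i \<Rightarrow> real^'n^'n"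
  mB :: "'i \<Rightarrow> real^'m^'n"
  Wset :: "'i \<Rightarrow> (real^'n) set"
  Xset :: "'i \<Rightarrow> (real^'n) set"
  Uset :: "'i \<Rightarrow> (real^'m) set"
  mF :: "'i \<Rightarrow> real^'n^'c"
  mG :: "'i \<Rightarrow> real^'m^'c"
  bvec :: "'i \<Rightarrow> real^'c"
  mQ :: "'i \<Rightarrow> real^'n^'n"
  mR :: "'i \<Rightarrow> real^'m^'m"
  Kp :: "'i \<Rightarrow> real^'n^'m"
  ltil :: "'i \<Rightarrow> (real^'n) \<times> (real^'m) \<Rightarrow> real"
  zst :: "'i \<Rightarrow> (real^'n) \<times> (real^'m)"  \<comment> \<open>the steady state \<open>(s\<^sub>i\<^sup>*, v\<^sub>i\<^sup>*)\<close>\<close>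
  mP :: "'i \<Rightarrow> real^'n^'n"
  hor :: nat

abbreviation sst :: "('i, 'n::finite, 'm::finite, 'c::finite) rhg \<Rightarrow> 'i \<Rightarrow> real^'n" where
  "sst g i \<equiv> fst (zst g i)"

abbreviation vst :: "('i, 'n::finite, 'm::finite, 'c::finite) rhg \<Rightarrow> 'i \<Rightarrow> real^'m" where
  "vst g i \<equiv> snd (zst g i)"

definition connected_undirected :: "('i \<times> 'i) set \<Rightarrow> bool" where
  "connected_undirected E \<longleftrightarrow> sym E \<and> (\<forall>i j. (i, j) \<in> E\<^sup>*)"

definition nbrs :: "('i, 'n::finite, 'm::finite, 'c::finite) rhg \<Rightarrow> 'i \<Rightarrow> 'i set" where
  "nbrs g i = {j. j = i \<or> (i, j) \<in> edges g}"

definition standing_assumptions ::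
    "('i::finite, 'n::finite, 'm::finite, 'c::finite) rhg \<Rightarrow> bool" where
  "standing_assumptions g \<longleftrightarrow>
     connected_undirected (edges g) \<and>
     (\<forall>i. compact (Wset g i) \<and> convex (Wset g i) \<and> 0 \<in> interior (Wset g i) \<and>
          Xset g i \<noteq> {} \<and> compact (Xset g i) \<and> convex (Xset g i) \<and>
          Uset g i \<noteq> {} \<and> compact (Uset g i) \<and> convex (Uset g i) \<and>
          stabilizable (mA g i) (mB g i) \<and>
          sym_pos_def (mQ g i) \<and> sym_pos_def (mR g i))"


section \<open>Constraint tightening\<close>

definition Phi :: "('i, 'n::finite, 'm::finite, 'c::finite) rhg \<Rightarrow> 'i \<Rightarrow> real^'n^'n" where
  "Phi g i = mA g i + mB g i ** Kp g i"

definition Zinf :: "('i, 'n::finite, 'm::finite, 'c::finite) rhg \<Rightarrow> 'i \<Rightarrow> (real^'n) set" where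
  "Zinf g i = minkowski_series (Phi g i) (Wset g i)"

definition Sset :: "('i, 'n::finite, 'm::finite, 'c::finite) rhg \<Rightarrow> 'i \<Rightarrow> (real^'n) set" where
  "Sset g i = Xset g i \<ominus>\<^sub>P Zinf g i"

definition Vset :: "('i, 'n::finite, 'm::finite, 'c::finite) rhg \<Rightarrow> 'i \<Rightarrow> (real^'m) set" where
  "Vset g i = Uset g i \<ominus>\<^sub>P ((*v) (Kp g i) ` Zinf g i)"

text \<open>The supremum is a maximum, \<open>Zinf g j\<close> being compact under the standing assumptions.\<close>
definition dvec :: "('i, 'n::finite, 'm::finite, 'c::finite) rhg \<Rightarrow> 'i \<Rightarrow> real^'c" where
  "dvec g j = (\<chi> l. SUP e\<in>Zinf g j. inner (row l (mF g j + mG g j ** Kp g j)) e)"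

definition bbar :: "('i::finite, 'n::finite, 'm::finite, 'c::finite) rhg \<Rightarrow> 'i \<Rightarrow> real^'c" where
  "bbar g i = bvec g i - (\<Sum>j\<in>nbrs g i. dvec g j)"


section \<open>Steady-state variational GNE\<close>

definition steady_set ::
    "('i::finite, 'n::finite, 'm::finite, 'c::finite) rhg
      \<Rightarrow> ('i \<Rightarrow> (real^'n) \<times> (real^'m)) set" where
  "steady_set g = {z. \<forall>i.
     fst (z i) = mA g i *v fst (z i) + mB g i *v snd (z i) \<and>
     fst (z i) \<in> Sset g i \<and> snd (z i) \<in> Vset g i \<and>
     (\<Sum>j\<in>nbrs g i. mF g j *v fst (z j) + mG g j *v snd (z j)) \<le> bbar g i}"

definition steady_vgne ::
    "('i::finite, 'n::finite, 'm::finite, 'c::finite) rhg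
      \<Rightarrow> ('i \<Rightarrow> (real^'n) \<times> (real^'m)) \<Rightarrow> bool" where
  "steady_vgne g zs \<longleftrightarrow> zs \<in> steady_set g \<and>
     (\<forall>z\<in>steady_set g. 0 \<le> (\<Sum>i\<in>UNIV. inner (gradient (ltil g i) (zs i)) (z i - zs i)))"


section \<open>Terminal ingredients\<close>

definition Kf :: "('i, 'n::finite, 'm::finite, 'c::finite) rhg \<Rightarrow> 'i \<Rightarrow> real^'n^'m" where
  "Kf g i = - (matrix_inv (mR g i + transpose (mB g i) ** mP g i ** mB g i)
                 ** transpose (mB g i) ** mP g i ** mA g i)"

definition dare_stabilizing ::
    "('i, 'n::finite, 'm::finite, 'c::finite) rhg \<Rightarrow> 'i \<Rightarrow> bool" where
  "dare_stabilizing g i \<longleftrightarrow> (let A = mA g i; B = mB g i; Q = mQ g i; R = mR g i; P = mP g i in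
     sym_pos_def P \<and>
     P = Q + transpose A ** P ** A
           - transpose A ** P ** B ** matrix_inv (R + transpose B ** P ** B)
               ** transpose B ** P ** A \<and>
     schur_stable (A + B ** Kf g i))"

definition kappa ::
    "('i, 'n::finite, 'm::finite, 'c::finite) rhg \<Rightarrow> 'i \<Rightarrow> real^'n \<Rightarrow> real^'m" where
  "kappa g i s = vst g i + Kf g i *v (s - sst g i)"

definition lf :: "('i, 'n::finite, 'm::finite, 'c::finite) rhg \<Rightarrow> 'i \<Rightarrow> real^'n \<Rightarrow> real" where
  "lf g i s = wnorm2 (mP g i) (s - sst g i)"

text \<open>\<open>share g i j\<close> is the share offered to agent \<open>j\<close> by the shared constraint of agent \<open>i\<close>.\<close>
definition share ::
    "('i::finite, 'n::finite, 'm::finite, 'c::finite) rhg \<Rightarrow> 'i \<Rightarrow> 'i \<Rightarrow> real^'c" where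
  "share g i j = mF g j *v sst g j + mG g j *v vst g j
     + (1 / real (card (nbrs g i))) *\<^sub>R
         (bbar g i - (\<Sum>k\<in>nbrs g i. mF g k *v sst g k + mG g k *v vst g k))"

definition alpha ::
    "('i::finite, 'n::finite, 'm::finite, 'c::finite) rhg \<Rightarrow> 'i \<Rightarrow> real^'c" where
  "alpha g j = (\<chi> l. Min ((\<lambda>i. share g i j $ l) ` {i. j \<in> nbrs g i}))"

definition terminal_admissible ::
    "('i::finite, 'n::finite, 'm::finite, 'c::finite) rhg \<Rightarrow> 'i \<Rightarrow> (real^'n) set \<Rightarrow> bool" where
  "terminal_admissible g i T \<longleftrightarrow> T \<subseteq> Sset g i \<and>
     (\<forall>s\<in>T. kappa g i s \<in> Vset g i \<and>
            mF g i *v s + mG g i *v kappa g i s \<le> alpha g i \<and>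
            mA g i *v s + mB g i *v kappa g i s \<in> T)"

definition Sf ::
    "('i::finite, 'n::finite, 'm::finite, 'c::finite) rhg \<Rightarrow> 'i \<Rightarrow> (real^'n) set" where
  "Sf g i = \<Union> {T. terminal_admissible g i T}"

lemma Sf_largest:
  "terminal_admissible g i (Sf g i)"
  "terminal_admissible g i T \<Longrightarrow> T \<subseteq> Sf g i"
  unfolding Sf_def terminal_admissible_def by blast+


section \<open>Receding horizon game\<close>

text \<open>
  A trajectory \<open>(s, v)\<close> of one agent stands for the vector
  \<open>(s 0, \<dots>, s H, v 0, \<dots>, v (H - 1))\<close> with \<open>H\<close> the horizon.  The other values
  of \<open>s\<close> and \<open>v\<close> are irrelevant: nothing below depends on them.
\<close>
type_synonym ('n, 'm) traj = "(nat \<Rightarrow> real^'n) \<times> (nat \<Rightarrow> real^'m)"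

definition lp ::
    "('i, 'n::finite, 'm::finite, 'c::finite) rhg \<Rightarrow> 'i \<Rightarrow> real^'n \<Rightarrow> real^'m \<Rightarrow> real" where
  "lp g i s v = wnorm2 (mQ g i) (s - sst g i) + wnorm2 (mR g i) (v - vst g i)"

definition J :: "('i, 'n::finite, 'm::finite, 'c::finite) rhg \<Rightarrow> 'i \<Rightarrow> ('n, 'm) traj \<Rightarrow> real" where
  "J g i z = (\<Sum>k<hor g. lp g i (fst z k) (snd z k)) + lf g i (fst z (hor g))"

definition V ::
    "('i::finite, 'n::finite, 'm::finite, 'c::finite) rhg \<Rightarrow> ('i \<Rightarrow> ('n, 'm) traj) \<Rightarrow> real" where
  "V g z = (\<Sum>i\<in>UNIV. J g i (z i))"

text \<open>
  The horizon is a number, so the space of trajectories is not itself an instance of a Euclidean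
  space; the gradient of the cost and the inner product are written blockwise.
\<close>
definition grad_J ::
    "('i, 'n::finite, 'm::finite, 'c::finite) rhg \<Rightarrow> 'i \<Rightarrow> ('n, 'm) traj \<Rightarrow> ('n, 'm) traj" where
  "grad_J g i z =
     (\<lambda>k. gradient (\<lambda>y. J g i ((fst z)(k := y), snd z)) (fst z k),
      \<lambda>k. gradient (\<lambda>y. J g i (fst z, (snd z)(k := y))) (snd z k))"

definition traj_inner :: "nat \<Rightarrow> ('n::finite, 'm::finite) traj \<Rightarrow> ('n, 'm) traj \<Rightarrow> real" where
  "traj_inner H p q =
     (\<Sum>k\<le>H. inner (fst p k) (fst q k)) + (\<Sum>k<H. inner (snd p k) (snd q k))"

definition traj_diff :: "('n::finite, 'm::finite) traj \<Rightarrow> ('n, 'm) traj \<Rightarrow> ('n, 'm) traj" where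
  "traj_diff p q = (\<lambda>k. fst p k - fst q k, \<lambda>k. snd p k - snd q k)"

definition feasible ::
    "('i::finite, 'n::finite, 'm::finite, 'c::finite) rhg \<Rightarrow> ('i \<Rightarrow> real^'n)
      \<Rightarrow> ('i \<Rightarrow> ('n, 'm) traj) set" where
  "feasible g x = {z. \<forall>i.
     (\<forall>k<hor g.
        fst (z i) (Suc k) = mA g i *v fst (z i) k + mB g i *v snd (z i) k \<and>
        fst (z i) k \<in> Sset g i \<and> snd (z i) k \<in> Vset g i \<and>
        (\<Sum>j\<in>nbrs g i. mF g j *v fst (z j) k + mG g j *v snd (z j) k) \<le> bbar g i) \<and>
     fst (z i) (hor g) \<in> Sf g i \<and>
     x i - fst (z i) 0 \<in> Zinf g i}"

definition rhg_vgne ::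
    "('i::finite, 'n::finite, 'm::finite, 'c::finite) rhg \<Rightarrow> ('i \<Rightarrow> real^'n)
      \<Rightarrow> ('i \<Rightarrow> ('n, 'm) traj) \<Rightarrow> bool" where
  "rhg_vgne g x zs \<longleftrightarrow> zs \<in> feasible g x \<and>
     (\<forall>z\<in>feasible g x.
        0 \<le> (\<Sum>i\<in>UNIV. traj_inner (hor g) (grad_J g i (zs i)) (traj_diff (z i) (zs i))))"

definition applied_input ::
    "('i, 'n::finite, 'm::finite, 'c::finite) rhg \<Rightarrow> ('i \<Rightarrow> real^'n)
      \<Rightarrow> ('i \<Rightarrow> ('n, 'm) traj) \<Rightarrow> 'i \<Rightarrow> real^'m" where
  "applied_input g x zs i = snd (zs i) 0 + Kp g i *v (x i - fst (zs i) 0)"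

end

theory Submission
  imports Defs
begin

text \<open>
  The game is a potential game: stacking the gradients of the \<open>J\<^sub>i\<close> gives the gradient of the
  convex function \<open>V\<close>, so the vGNE minimizes \<open>V\<close> over the joint feasible set.  Shifting the vGNE
  by one step and appending the terminal controller gives a feasible point of the next game, since
  the shares \<open>\<alpha>\<^sub>j\<close> of the agents in a neighborhood sum to at most the available budget.  By the
  Riccati equation the cost of this point is exactly \<open>V\<close> minus the first stage cost, hence \<open>V\<close>
  decreases along the closed loop, the stage costs vanish and the nominal states and inputs
  converge.
\<close>

section \<open>Weighted squared norms, and the Minkowski series of the disturbances\<close>

lemma wnorm2_zero [simp]: "wnorm2 M 0 = 0"
  by (simp add: wnorm2_def)

lemma wnorm2_nonneg: "sym_pos_def M \<Longrightarrow> 0 \<le> wnorm2 M x"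
  unfolding sym_pos_def_def wnorm2_def by (cases "x = 0") (auto intro: less_imp_le)

lemma inner_transpose_mult:
  fixes A :: "real^'m^'n"
  shows "inner x (transpose A *v y) = inner (A *v x) y"
  by (metis dot_lmul_matrix inner_commute transpose_matrix_vector)

lemma sym_pos_def_inner:
  assumes "sym_pos_def M"
  shows "inner (M *v x) y = inner x (M *v y)"
  using assms inner_transpose_mult[of x M y] unfolding sym_pos_def_def by simp

lemma wnorm2_add:
  assumes "sym_pos_def M"
  shows "wnorm2 M (x + y) = wnorm2 M x + 2 * inner (M *v x) y + wnorm2 M y"
  using sym_pos_def_inner[OF assms, of x y] inner_commute[of "M *v x" y]
  by (simp add: wnorm2_def matrix_vector_right_distrib inner_add_left inner_add_right)

text \<open>The remainder of the expansion around \<open>x\<close> is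
  \<open>wnorm2 M (y - x)\<close>, which is nonnegative.\<close>

lemma wnorm2_convex:
  assumes "sym_pos_def M"
  shows "wnorm2 M x + inner (2 *\<^sub>R (M *v x)) (y - x) \<le> wnorm2 M y"
  using wnorm2_add[OF assms, of x "y - x"] wnorm2_nonneg[OF assms, of "y - x"] by simp

text \<open>The cost has the form \<open>c + wnorm2 M (y - a)\<close> in each single state or input
  block.\<close>

lemma gradient_wnorm2:
  assumes M: "sym_pos_def M"
  shows "gradient (\<lambda>y. c + wnorm2 M (y - a)) x = 2 *\<^sub>R (M *v (x - a))"
proof (rule gradient_eqI)
  have lin: "((\<lambda>y. M *v (y - a)) has_derivative (\<lambda>h. M *v h)) (at x)"
    by (auto intro!: derivative_eq_intros bounded_linear.has_derivative[OF matrix_vector_mul_bounded_linear])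
  have "((\<lambda>y. c + wnorm2 M (y - a)) has_derivative
      (\<lambda>h. inner (x - a) (M *v h) + inner h (M *v (x - a)))) (at x)"
    unfolding wnorm2_def by (auto intro!: derivative_eq_intros lin)
  moreover have "inner (x - a) (M *v h) = inner h (M *v (x - a))" for h
    using sym_pos_def_inner[OF M, of h "x - a"] by (simp add: inner_commute)
  ultimately show "GDERIV (\<lambda>y. c + wnorm2 M (y - a)) x :> 2 *\<^sub>R (M *v (x - a))"
    unfolding gderiv_def by simp
qed

text \<open>The minimum over the compact unit sphere serves as \<mu>. It is positive because it is
  attained at a nonzero vector, and homogeneity of degree two extends the bound to all
  vectors.\<close>

lemma wnorm2_lower_bound:
  fixes M :: "real^'n^'n"
  assumes M: "sym_pos_def M"
  obtains \<mu> where "0 < \<mu>" "\<And>x. \<mu> * (norm x)\<^sup>2 \<le> wnorm2 M x"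
proof -
  let ?S = "sphere 0 1 :: (real^'n) set"
  have cont: "continuous_on ?S (wnorm2 M)"
    unfolding wnorm2_def
    by (intro continuous_intros linear_continuous_on matrix_vector_mul_bounded_linear)
  obtain y where y: "y \<in> ?S" "\<And>x. x \<in> ?S \<Longrightarrow> wnorm2 M y \<le> wnorm2 M x"
    using continuous_attains_inf[OF compact_sphere _ cont] by auto
  show thesis
  proof
    have "y \<noteq> 0" using y(1) by auto
    then show "0 < wnorm2 M y"
      using M unfolding sym_pos_def_def wnorm2_def by blast
    show "wnorm2 M y * (norm x)\<^sup>2 \<le> wnorm2 M x" for x
    proof (cases "x = 0")
      case False
      define u where "u = (1 / norm x) *\<^sub>R x"
      have "u \<in> ?S" using False by (simp add: u_def)
      moreover have "wnorm2 M x = (norm x)\<^sup>2 * wnorm2 M u"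
        using False by (simp add: u_def wnorm2_def matrix_vector_mult_scaleR power2_eq_square)
      ultimately show ?thesis
        using y(2)[of u] by (simp add: mult.commute[of "(norm x)\<^sup>2"] mult_right_mono)
    qed simp
  qed
qed

lemma wnorm2_tendsto_zero:
  assumes M: "sym_pos_def M" and lim: "(\<lambda>t. wnorm2 M (f t)) \<longlonglongrightarrow> 0"
  shows "(\<lambda>t. norm (f t)) \<longlonglongrightarrow> 0"
proof -
  obtain \<mu> where \<mu>: "0 < \<mu>" "\<And>x. \<mu> * (norm x)\<^sup>2 \<le> wnorm2 M x"
    using wnorm2_lower_bound[OF M] by blast
  have upper: "(\<lambda>t. wnorm2 M (f t) / \<mu>) \<longlonglongrightarrow> 0"
    using tendsto_divide[OF lim tendsto_const[of \<mu>]] \<mu>(1) by simp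
  have "(norm (f t))\<^sup>2 \<le> wnorm2 M (f t) / \<mu>" for t
    using \<mu>(2)[of "f t"] \<mu>(1) by (simp add: field_simps)
  then have "(\<lambda>t. (norm (f t))\<^sup>2) \<longlonglongrightarrow> 0"
    by (intro tendsto_sandwich[OF _ _ tendsto_const upper] always_eventually allI) auto
  then show ?thesis by simp
qed

text \<open>Multiplying by \<open>M\<close> moves every term of the series up by one power, which
  frees index 0 for \<open>w\<close>. So the sequence \<omega> with \<open>w\<close> prepended
  represents \<open>M *v e + w\<close>.\<close>

lemma minkowski_series_invariant:
  assumes "e \<in> minkowski_series M W" "w \<in> W"
  shows "M *v e + w \<in> minkowski_series M W"
proof -
  obtain \<omega> where \<omega>: "\<And>n. \<omega> n \<in> W" "(\<lambda>n. (((*v) M) ^^ n) (\<omega> n)) sums e"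
    using assms(1) unfolding minkowski_series_def by blast
  let ?\<omega>' = "case_nat w \<omega>"
  have "(\<lambda>n. M *v (((*v) M) ^^ n) (\<omega> n)) sums (M *v e)"
    by (rule bounded_linear.sums[OF matrix_vector_mul_bounded_linear \<omega>(2)])
  then have "(\<lambda>n. (((*v) M) ^^ Suc n) (?\<omega>' (Suc n))) sums (M *v e)"
    by simp
  then have "(\<lambda>n. (((*v) M) ^^ n) (?\<omega>' n)) sums (M *v e + (((*v) M) ^^ 0) (?\<omega>' 0))"
    by (rule sums_Suc)
  moreover have "\<forall>n. ?\<omega>' n \<in> W"
    using \<omega>(1) assms(2) by (simp split: nat.split)
  ultimately show ?thesis
    unfolding minkowski_series_def by (auto intro!: exI[of _ ?\<omega>'])
qed

section \<open>The vGNE as a minimizer of \<open>V\<close>\<close>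

text \<open>The constant \<open>c\<close> collects the terms of all other blocks. Its value is
  irrelevant, since it vanishes in the gradient.\<close>

lemma J_update_state:
  assumes "k < hor g"
  shows "\<exists>c. \<forall>y. J g i (s(k := y), v) = c + wnorm2 (mQ g i) (y - sst g i)"
proof -
  have eq: "J g i (s(k := y), v) =
      (\<Sum>j\<in>{..<hor g} - {k}. lp g i (s j) (v j)) + wnorm2 (mR g i) (v k - vst g i)
        + lf g i (s (hor g)) + wnorm2 (mQ g i) (y - sst g i)" for y
    using assms by (simp add: J_def sum.remove[of "{..<hor g}" k] lp_def)
  show ?thesis by (intro exI allI) (rule eq)
qed

lemma J_update_last_state:
  shows "\<exists>c. \<forall>y. J g i (s(hor g := y), v) = c + wnorm2 (mP g i) (y - sst g i)"
proof -
  have eq: "J g i (s(hor g := y), v) =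
      (\<Sum>j<hor g. lp g i (s j) (v j)) + wnorm2 (mP g i) (y - sst g i)" for y
    by (simp add: J_def lf_def)
  show ?thesis by (intro exI allI) (rule eq)
qed

lemma J_update_input:
  assumes "k < hor g"
  shows "\<exists>c. \<forall>y. J g i (s, v(k := y)) = c + wnorm2 (mR g i) (y - vst g i)"
proof -
  have eq: "J g i (s, v(k := y)) =
      (\<Sum>j\<in>{..<hor g} - {k}. lp g i (s j) (v j)) + wnorm2 (mQ g i) (s k - sst g i)
        + lf g i (s (hor g)) + wnorm2 (mR g i) (y - vst g i)" for y
    using assms by (simp add: J_def sum.remove[of "{..<hor g}" k] lp_def)
  show ?thesis by (intro exI allI) (rule eq)
qed

text \<open>The cost is a sum of separate quadratics, one per state or input block, so its
  first-order convexity inequality is the sum of those of the blocks.\<close>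

lemma J_convex:
  fixes g :: "('i::finite, 'n::finite, 'm::finite, 'c::finite) rhg"
  assumes Q: "sym_pos_def (mQ g i)" and R: "sym_pos_def (mR g i)" and P: "sym_pos_def (mP g i)"
  shows "J g i z + traj_inner (hor g) (grad_J g i z) (traj_diff z' z) \<le> J g i z'"
proof -
  let ?H = "hor g"
  let ?s = "\<lambda>k. 2 *\<^sub>R (mQ g i *v (fst z k - sst g i))"
  let ?v = "\<lambda>k. 2 *\<^sub>R (mR g i *v (snd z k - vst g i))"
  let ?f = "2 *\<^sub>R (mP g i *v (fst z ?H - sst g i))"
  have gs: "fst (grad_J g i z) k = ?s k" if k: "k < ?H" for k
  proof -
    obtain c where "\<forall>y. J g i ((fst z)(k := y), snd z) = c + wnorm2 (mQ g i) (y - sst g i)"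
      using J_update_state[OF k, of i "fst z" "snd z"] ..
    then show ?thesis by (simp add: grad_J_def gradient_wnorm2[OF Q])
  qed
  have gf: "fst (grad_J g i z) ?H = ?f"
  proof -
    obtain c where "\<forall>y. J g i ((fst z)(?H := y), snd z) = c + wnorm2 (mP g i) (y - sst g i)"
      using J_update_last_state[of g i "fst z" "snd z"] ..
    then show ?thesis by (simp add: grad_J_def gradient_wnorm2[OF P])
  qed
  have gv: "snd (grad_J g i z) k = ?v k" if k: "k < ?H" for k
  proof -
    obtain c where "\<forall>y. J g i (fst z, (snd z)(k := y)) = c + wnorm2 (mR g i) (y - vst g i)"
      using J_update_input[OF k, of i "fst z" "snd z"] ..
    then show ?thesis by (simp add: grad_J_def gradient_wnorm2[OF R])
  qed
  have stage: "lp g i (fst z k) (snd z k) + (inner (?s k) (fst z' k - fst z k)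
      + inner (?v k) (snd z' k - snd z k)) \<le> lp g i (fst z' k) (snd z' k)" for k
    using wnorm2_convex[OF Q, of "fst z k - sst g i" "fst z' k - sst g i"]
      wnorm2_convex[OF R, of "snd z k - vst g i" "snd z' k - vst g i"]
    by (simp add: lp_def)
  have final: "lf g i (fst z ?H) + inner ?f (fst z' ?H - fst z ?H) \<le> lf g i (fst z' ?H)"
    using wnorm2_convex[OF P, of "fst z ?H - sst g i" "fst z' ?H - sst g i"] by (simp add: lf_def)
  \<comment> \<open>States run up to index \<open>?H\<close>, inputs only up to
    \<open>?H - 1\<close>. Splitting off the last state leaves two sums over the same
    stages.\<close>
  have "traj_inner ?H (grad_J g i z) (traj_diff z' z) =
      (\<Sum>k<?H. inner (?s k) (fst z' k - fst z k) + inner (?v k) (snd z' k - snd z k))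
        + inner ?f (fst z' ?H - fst z ?H)"
    unfolding traj_inner_def traj_diff_def lessThan_Suc_atMost[symmetric] sum.lessThan_Suc
    by (simp add: gs gv gf sum.distrib)
  moreover have "(\<Sum>k<?H. lp g i (fst z k) (snd z k) + (inner (?s k) (fst z' k - fst z k)
      + inner (?v k) (snd z' k - snd z k))) \<le> (\<Sum>k<?H. lp g i (fst z' k) (snd z' k))"
    by (intro sum_mono stage)
  ultimately show ?thesis
    using final by (simp add: J_def sum.distrib)
qed

text \<open>Each \<open>J g i\<close> depends on the trajectory of agent \<open>i\<close> alone, so
  the variational inequality bounds the derivative of \<open>V\<close> at \<open>z\<close> towards
  \<open>z'\<close> from below by 0. Convexity turns this into a comparison of values.\<close>

lemma rhg_vgne_minimizes_V:
  assumes "\<And>i. sym_pos_def (mQ g i)" "\<And>i. sym_pos_def (mR g i)" "\<And>i. sym_pos_def (mP g i)"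
    and "rhg_vgne g x z" "z' \<in> feasible g x"
  shows "V g z \<le> V g z'"
proof -
  have "0 \<le> (\<Sum>i\<in>UNIV. traj_inner (hor g) (grad_J g i (z i)) (traj_diff (z' i) (z i)))"
    using assms(4,5) unfolding rhg_vgne_def by blast
  also have "\<dots> \<le> (\<Sum>i\<in>UNIV. J g i (z' i) - J g i (z i))"
    using J_convex[OF assms(1-3)] by (intro sum_mono) (simp add: le_diff_eq add.commute)
  finally show ?thesis by (simp add: V_def sum_subtractf)
qed

section \<open>The Riccati equation and the terminal cost\<close>

lemma invertible_if_pos_def:
  fixes M :: "real^'n^'n"
  assumes "\<And>x. x \<noteq> 0 \<Longrightarrow> 0 < inner x (M *v x)"
  shows "invertible M"
proof -
  have "x = 0" if "M *v x = 0" for x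
    using assms[of x] that by fastforce
  then show ?thesis
    by (simp add: invertible_left_inverse matrix_left_invertible_ker)
qed

lemma matrix_mult_uminus_right:
  fixes A :: "'a::ring_1^'n^'m"
  shows "A ** (- B) = - (A ** B)"
  by (simp add: vec_eq_iff matrix_matrix_mult_def sum_negf)

lemma matrix_vector_mult_minus_left:
  fixes A :: "'a::ring_1^'n^'m"
  shows "(- A) *v x = - (A *v x)"
  by (simp add: vec_eq_iff matrix_vector_mult_def sum_negf)

text \<open>This is the stationarity condition of the LQR gain. The inverse in \<open>Kf\<close>
  cancels because R + B^T P B is positive definite: R is, and the other summand contributes the
  P-norm of B u.\<close>

lemma Kf_equation:
  assumes R: "sym_pos_def (mR g i)" and P: "sym_pos_def (mP g i)"
  shows "(mR g i + transpose (mB g i) ** mP g i ** mB g i) ** Kf g i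
      = - (transpose (mB g i) ** mP g i ** mA g i)"
proof -
  let ?M = "mR g i + transpose (mB g i) ** mP g i ** mB g i"
  have "0 < inner u (?M *v u)" if "u \<noteq> 0" for u
  proof -
    have "inner u ((transpose (mB g i) ** mP g i ** mB g i) *v u) = wnorm2 (mP g i) (mB g i *v u)"
      unfolding wnorm2_def
      by (simp add: matrix_vector_mul_assoc[symmetric] inner_transpose_mult
          del: transpose_matrix_vector)
    then show ?thesis
      using R that wnorm2_nonneg[OF P, of "mB g i *v u"]
      by (simp add: sym_pos_def_def matrix_vector_mult_add_rdistrib inner_add_right add_pos_nonneg)
  qed
  then have "invertible ?M" by (rule invertible_if_pos_def)
  then have "?M ** matrix_inv ?M = mat 1"
    unfolding invertible_def matrix_inv_def by (rule someI2_ex) simp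
  then show ?thesis
    unfolding Kf_def by (simp add: matrix_mult_uminus_right matrix_mul_assoc)
qed

text \<open>Let e be the deviation from the steady state and u = Kf e. The Riccati equation paired
  with e and the gain equation paired with u each yield the cross term <A e, P B u>. These cancel
  the mixed term of the squared P-norm of A e + B u, hence an equality.\<close>

lemma terminal_cost_decrease:
  fixes g :: "('i::finite, 'n::finite, 'm::finite, 'c::finite) rhg"
  assumes Q: "sym_pos_def (mQ g i)" and R: "sym_pos_def (mR g i)" and "dare_stabilizing g i"
    and st: "sst g i = mA g i *v sst g i + mB g i *v vst g i"
  shows "lf g i (mA g i *v s + mB g i *v kappa g i s) + lp g i s (kappa g i s) = lf g i s"
proof -
  let ?A = "mA g i" and ?B = "mB g i" and ?P = "mP g i" and ?K = "Kf g i"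
  let ?M = "mR g i + transpose ?B ** ?P ** ?B"
  define e where "e = s - sst g i"
  define u where "u = ?K *v e"
  have P: "sym_pos_def ?P"
    and dare: "?P = mQ g i + transpose ?A ** ?P ** ?A
           - transpose ?A ** ?P ** ?B ** matrix_inv ?M ** transpose ?B ** ?P ** ?A"
    using assms(3) unfolding dare_stabilizing_def Let_def by auto
  \<comment> \<open>The term with the inverse in the Riccati equation is a multiple of
    \<open>?K\<close>, so the equation can be rewritten without the inverse.\<close>
  have "transpose ?A ** ?P ** ?B ** ?K
      = - (transpose ?A ** ?P ** ?B ** matrix_inv ?M ** transpose ?B ** ?P ** ?A)"
    unfolding Kf_def by (simp add: matrix_mult_uminus_right matrix_mul_assoc)
  with dare have "?P = mQ g i + transpose ?A ** ?P ** ?A + transpose ?A ** ?P ** ?B ** ?K"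
    by simp
  then have "?P *v e = (mQ g i + transpose ?A ** ?P ** ?A + transpose ?A ** ?P ** ?B ** ?K) *v e"
    by simp
  also have "\<dots> = mQ g i *v e + transpose ?A *v (?P *v (?A *v e))
      + transpose ?A *v (?P *v (?B *v u))"
    by (simp add: u_def matrix_vector_mult_add_rdistrib matrix_vector_mul_assoc matrix_mul_assoc
        del: transpose_matrix_vector)
  finally have Pe: "wnorm2 ?P e = wnorm2 (mQ g i) e + wnorm2 ?P (?A *v e)
      + inner (?A *v e) (?P *v (?B *v u))"
    by (simp add: wnorm2_def inner_add_right inner_transpose_mult del: transpose_matrix_vector)
  have "?M *v u = - (transpose ?B ** ?P ** ?A) *v e"
    using Kf_equation[OF R P] by (simp add: u_def matrix_vector_mul_assoc)
  then have "mR g i *v u + transpose ?B *v (?P *v (?B *v u)) = - (transpose ?B *v (?P *v (?A *v e)))"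
    by (simp add: matrix_vector_mult_add_rdistrib matrix_vector_mul_assoc matrix_mul_assoc
        matrix_vector_mult_minus_left del: transpose_matrix_vector)
  then have "inner u (mR g i *v u + transpose ?B *v (?P *v (?B *v u)))
      = inner u (- (transpose ?B *v (?P *v (?A *v e))))"
    by (rule arg_cong)
  then have Ru: "wnorm2 (mR g i) u + wnorm2 ?P (?B *v u) = - inner (?B *v u) (?P *v (?A *v e))"
    by (simp add: wnorm2_def inner_add_right inner_transpose_mult del: transpose_matrix_vector)
  have cross: "inner (?P *v (?A *v e)) (?B *v u) = inner (?A *v e) (?P *v (?B *v u))"
    by (rule sym_pos_def_inner[OF P])
  \<comment> \<open>Subtracting the steady-state equation shows that deviations obey the linear
    dynamics.\<close>
  have "?A *v s + ?B *v kappa g i s - sst g i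
      = ?A *v s + ?B *v kappa g i s - (?A *v sst g i + ?B *v vst g i)"
    using st by simp
  also have "\<dots> = ?A *v e + ?B *v u"
    by (simp add: kappa_def e_def u_def matrix_vector_right_distrib matrix_vector_mult_diff_distrib)
  finally have "lf g i (?A *v s + ?B *v kappa g i s) = wnorm2 ?P (?A *v e + ?B *v u)"
    by (simp add: lf_def)
  moreover have "lp g i s (kappa g i s) = wnorm2 (mQ g i) e + wnorm2 (mR g i) u"
    by (simp add: lp_def kappa_def e_def u_def)
  moreover have "lf g i s = wnorm2 ?P e"
    by (simp add: lf_def e_def)
  ultimately show ?thesis
    using Pe Ru cross wnorm2_add[OF P, of "?A *v e" "?B *v u"]
      inner_commute[of "?B *v u" "?P *v (?A *v e)"] by simp
qed

section \<open>The shifted candidate: feasibility and cost\<close>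

text \<open>As a minimum over all constraints involving agent \<open>j\<close>,
  \<open>alpha g j\<close> is at most the share that constraint \<open>i\<close> offers. Those
  shares split the slack of constraint \<open>i\<close> equally, so they add up to its
  budget.\<close>

lemma sum_alpha_le:
  fixes g :: "('i::finite, 'n::finite, 'm::finite, 'c::finite) rhg"
  shows "(\<Sum>j\<in>nbrs g i. alpha g j) \<le> bbar g i"
proof -
  have "alpha g j $ l \<le> share g i j $ l" if "j \<in> nbrs g i" for j l
    using that by (auto simp: alpha_def intro!: Min_le)
  then have "(\<Sum>j\<in>nbrs g i. alpha g j) \<le> (\<Sum>j\<in>nbrs g i. share g i j)"
    by (auto simp: less_eq_vec_def intro!: sum_mono)
  \<comment> \<open>The neighborhood contains \<open>i\<close>, so its cardinality is nonzero and
    the equal parts of the slack sum to the whole.\<close>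
  also have "nbrs g i \<noteq> {}"
    by (auto simp: nbrs_def)
  then have "(\<Sum>j\<in>nbrs g i. share g i j) = bbar g i"
    by (simp add: share_def sum.distrib sum_constant_scaleR del: sum_constant)
  finally show ?thesis .
qed

text \<open>The old trajectory has a state at index H but its last input at H - 1. Hence the
  terminal controller already supplies the input at H - 1, while only the state at H is new.\<close>

definition shifted :: "('i::finite, 'n::finite, 'm::finite, 'c::finite) rhg
    \<Rightarrow> ('i \<Rightarrow> ('n, 'm) traj) \<Rightarrow> 'i \<Rightarrow> ('n, 'm) traj" where
  "shifted g z i = (let sH = fst (z i) (hor g) in
     (\<lambda>k. if k < hor g then fst (z i) (Suc k) else mA g i *v sH + mB g i *v kappa g i sH,
      \<lambda>k. if Suc k < hor g then snd (z i) (Suc k) else kappa g i sH))"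

lemma shifted_feasible:
  fixes g :: "('i::finite, 'n::finite, 'm::finite, 'c::finite) rhg"
  assumes H: "1 \<le> hor g" and z: "z \<in> feasible g x" and w: "\<And>i. w i \<in> Wset g i"
    and x': "\<And>i. x' i = mA g i *v x i + mB g i *v applied_input g x z i + w i"
  shows "shifted g z \<in> feasible g x'"
proof -
  have z1: "fst (z i) (Suc k) = mA g i *v fst (z i) k + mB g i *v snd (z i) k"
    "fst (z i) k \<in> Sset g i" "snd (z i) k \<in> Vset g i"
    "(\<Sum>j\<in>nbrs g i. mF g j *v fst (z j) k + mG g j *v snd (z j) k) \<le> bbar g i"
    if "k < hor g" for i k
    using z that unfolding feasible_def by auto
  have z2: "fst (z i) (hor g) \<in> Sf g i" "x i - fst (z i) 0 \<in> Zinf g i" for i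
    using z unfolding feasible_def by auto
  have Sf: "s \<in> Sset g i" "kappa g i s \<in> Vset g i"
      "mF g i *v s + mG g i *v kappa g i s \<le> alpha g i"
      "mA g i *v s + mB g i *v kappa g i s \<in> Sf g i" if "s \<in> Sf g i" for i s
    using Sf_largest(1)[of g i] that unfolding terminal_admissible_def by auto
  \<comment> \<open>Only the appended stage needs a new argument for the shared constraints: in the
    terminal sets every agent keeps to its own share.\<close>
  have "(\<Sum>j\<in>nbrs g i. mF g j *v fst (z j) (hor g) + mG g j *v kappa g j (fst (z j) (hor g)))
      \<le> (\<Sum>j\<in>nbrs g i. alpha g j)" for i
    using Sf(3)[OF z2(1)] by (auto simp: less_eq_vec_def intro!: sum_mono)
  then have coupling:
    "(\<Sum>j\<in>nbrs g i. mF g j *v fst (z j) (hor g) + mG g j *v kappa g j (fst (z j) (hor g)))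
      \<le> bbar g i" for i
    using sum_alpha_le order_trans by blast
  have step: "fst (shifted g z i) (Suc k)
        = mA g i *v fst (shifted g z i) k + mB g i *v snd (shifted g z i) k \<and>
      fst (shifted g z i) k \<in> Sset g i \<and> snd (shifted g z i) k \<in> Vset g i \<and>
      (\<Sum>j\<in>nbrs g i. mF g j *v fst (shifted g z j) k + mG g j *v snd (shifted g z j) k)
        \<le> bbar g i" if k: "k < hor g" for i k
  proof (cases "Suc k < hor g")
    case True
    then show ?thesis using z1[OF True] k by (simp add: shifted_def Let_def)
  next
    case False
    then have "Suc k = hor g" using k by simp
    then show ?thesis using k coupling Sf[OF z2(1)] by (simp add: shifted_def Let_def)
  qed
  have "fst (shifted g z i) (hor g) \<in> Sf g i" for i
    using Sf(4)[OF z2(1)] by (simp add: shifted_def Let_def)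
  moreover have "x' i - fst (shifted g z i) 0 \<in> Zinf g i" for i
  proof -
    \<comment> \<open>The new initial nominal state is the nominal successor of the old one. The
      feedback \<open>Kp\<close> thus leaves the error dynamics \<open>Phi\<close> plus disturbance,
      under which \<open>Zinf\<close> is invariant.\<close>
    have "x' i - fst (shifted g z i) 0 = Phi g i *v (x i - fst (z i) 0) + w i"
      using H z1(1)[of 0 i]
      by (simp add: shifted_def Let_def x' applied_input_def Phi_def algebra_simps
          matrix_vector_mult_diff_distrib matrix_vector_right_distrib
          matrix_vector_mult_add_rdistrib matrix_vector_mul_assoc[symmetric])
    then show ?thesis
      using minkowski_series_invariant[OF z2(2)[unfolded Zinf_def] w] by (simp add: Zinf_def)
  qed
  ultimately show ?thesis
    using step unfolding feasible_def by blast
qed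

text \<open>The shift drops the first stage cost, and the appended stage cost together with the new
  terminal cost equals the old terminal cost.\<close>

lemma J_shifted:
  fixes g :: "('i::finite, 'n::finite, 'm::finite, 'c::finite) rhg"
  assumes H: "1 \<le> hor g" and "sym_pos_def (mQ g i)" "sym_pos_def (mR g i)" "dare_stabilizing g i"
    and "sst g i = mA g i *v sst g i + mB g i *v vst g i"
  shows "J g i (shifted g z i) = J g i (z i) - lp g i (fst (z i) 0) (snd (z i) 0)"
proof -
  obtain h where h: "hor g = Suc h" using H by (cases "hor g") auto
  let ?l = "\<lambda>k. lp g i (fst (z i) k) (snd (z i) k)"
  let ?sH = "fst (z i) (Suc h)"
  have "J g i (shifted g z i) = (\<Sum>k<h. ?l (Suc k)) + lp g i ?sH (kappa g i ?sH)
      + lf g i (mA g i *v ?sH + mB g i *v kappa g i ?sH)"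
    by (simp add: J_def shifted_def h Let_def)
  also have "\<dots> = (\<Sum>k<h. ?l (Suc k)) + lf g i ?sH"
    using terminal_cost_decrease[OF assms(2-5), of ?sH] by simp
  also have "\<dots> = J g i (z i) - ?l 0"
    by (simp add: J_def h sum.lessThan_Suc_shift del: sum.lessThan_Suc)
  finally show ?thesis .
qed

section \<open>Recursive feasibility and convergence of the closed loop\<close>

theorem theorem2:
  fixes g :: "('i::finite, 'n::finite, 'm::finite, 'c::finite) rhg"
    and x w :: "nat \<Rightarrow> 'i \<Rightarrow> real^'n"
    and zs :: "nat \<Rightarrow> 'i \<Rightarrow> ('n, 'm) traj"
  assumes standing: "standing_assumptions g"
    and horizon: "1 \<le> hor g"
    and prestabilized: "\<And>i. schur_stable (Phi g i)"
    and steady_cost: "\<And>i. continuously_differentiable (ltil g i) \<and> strongly_convex (ltil g i)"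
    and steady_nonempty: "steady_set g \<noteq> {}"
    and steady: "steady_vgne g (zst g)"
    and riccati: "\<And>i. dare_stabilizing g i"
    and disturbance: "\<And>t i. w t i \<in> Wset g i"
    and vgne: "\<And>t. feasible g (x t) \<noteq> {} \<Longrightarrow> rhg_vgne g (x t) (zs t)"
    and closed_loop: "\<And>t i. x (Suc t) i =
          mA g i *v x t i + mB g i *v applied_input g (x t) (zs t) i + w t i"
    and feasible0: "feasible g (x 0) \<noteq> {}"
  shows "(\<forall>t. V g (zs (Suc t)) - V g (zs t)
              \<le> - (\<Sum>i\<in>UNIV. lp g i (fst (zs t i) 0) (snd (zs t i) 0)))
    \<and> (\<forall>i. (\<lambda>t. norm (fst (zs t i) 0 - sst g i)) \<longlonglongrightarrow> 0
           \<and> (\<lambda>t. norm (snd (zs t i) 0 - vst g i)) \<longlonglongrightarrow> 0)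
    \<and> (\<forall>i. (\<forall>t. infdist (x t i) ({sst g i} + Zinf g i) \<le> norm (fst (zs t i) 0 - sst g i))
           \<and> (\<lambda>t. norm (fst (zs t i) 0 - sst g i)) \<longlonglongrightarrow> 0
           \<and> (\<lambda>t. infdist (x t i) ({sst g i} + Zinf g i)) \<longlonglongrightarrow> 0)"
proof -
  have Q: "sym_pos_def (mQ g i)" and R: "sym_pos_def (mR g i)" for i
    using standing unfolding standing_assumptions_def by auto
  have P: "sym_pos_def (mP g i)" for i
    using riccati[of i] unfolding dare_stabilizing_def Let_def by auto
  have st: "sst g i = mA g i *v sst g i + mB g i *v vst g i" for i
    using steady unfolding steady_vgne_def steady_set_def by auto
  have shift: "shifted g (zs t) \<in> feasible g (x (Suc t))" if "rhg_vgne g (x t) (zs t)" for t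
    using that unfolding rhg_vgne_def
    by (intro shifted_feasible[OF horizon _ disturbance closed_loop]) auto
  \<comment> \<open>A nonempty feasible set provides a vGNE, whose shift is feasible at the next
    time for any disturbance.\<close>
  have nonempty: "feasible g (x t) \<noteq> {}" for t
  proof (induction t)
    case (Suc t)
    then show ?case using shift[OF vgne] by blast
  qed (rule feasible0)
  have vg: "rhg_vgne g (x t) (zs t)" for t
    by (rule vgne[OF nonempty])

  let ?l = "\<lambda>t i. lp g i (fst (zs t i) 0) (snd (zs t i) 0)"
  have decrease: "V g (zs (Suc t)) - V g (zs t) \<le> - (\<Sum>i\<in>UNIV. ?l t i)" for t
  proof -
    \<comment> \<open>The next vGNE is optimal among the feasible points, one of which is the
      shifted candidate.\<close>
    have "V g (zs (Suc t)) \<le> V g (shifted g (zs t))"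
      by (rule rhg_vgne_minimizes_V[OF Q R P vg shift[OF vg]])
    also have "\<dots> = V g (zs t) - (\<Sum>i\<in>UNIV. ?l t i)"
      by (simp add: V_def J_shifted[OF horizon Q R riccati st] sum_subtractf)
    finally show ?thesis by simp
  qed

  have lp_nonneg: "0 \<le> lp g i s v" for i s v
    by (simp add: lp_def wnorm2_nonneg[OF Q] wnorm2_nonneg[OF R])
  have V_nonneg: "0 \<le> V g z" for z
    by (auto simp: V_def J_def lf_def intro!: sum_nonneg add_nonneg_nonneg lp_nonneg wnorm2_nonneg[OF P])
  \<comment> \<open>All stage costs are nonnegative, so each single one is bounded by their
    sum.\<close>
  have l_le: "?l t i \<le> V g (zs t) - V g (zs (Suc t))" for t i
    using decrease[of t] member_le_sum[of i UNIV "?l t"] lp_nonneg by simp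
  then have "V g (zs (Suc t)) \<le> V g (zs t)" for t
    using lp_nonneg by (meson diff_ge_0_iff_ge order_trans)
  \<comment> \<open>A nonincreasing sequence bounded below converges, so its successive drops
    vanish. They squeeze the Q- and R-parts of every stage cost to 0.\<close>
  then have "decseq (\<lambda>t. V g (zs t))"
    by (rule decseq_SucI)
  then obtain L where L: "(\<lambda>t. V g (zs t)) \<longlonglongrightarrow> L"
    by (rule decseq_convergent) (use V_nonneg in auto)
  have drop: "(\<lambda>t. V g (zs t) - V g (zs (Suc t))) \<longlonglongrightarrow> 0"
    using tendsto_diff[OF L LIMSEQ_Suc[OF L]] by simp
  have "(\<lambda>t. wnorm2 (mQ g i) (fst (zs t i) 0 - sst g i)) \<longlonglongrightarrow> 0" for i
  proof (rule tendsto_sandwich[OF _ _ tendsto_const drop])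
    have "wnorm2 (mQ g i) (fst (zs t i) 0 - sst g i) \<le> V g (zs t) - V g (zs (Suc t))" for t
      using l_le[of i t] wnorm2_nonneg[OF R, of i "snd (zs t i) 0 - vst g i"] by (simp add: lp_def)
    then show "\<forall>\<^sub>F t in sequentially. wnorm2 (mQ g i) (fst (zs t i) 0 - sst g i)
        \<le> V g (zs t) - V g (zs (Suc t))"
      by simp
  qed (simp add: wnorm2_nonneg[OF Q])
  then have s_lim: "(\<lambda>t. norm (fst (zs t i) 0 - sst g i)) \<longlonglongrightarrow> 0" for i
    by (rule wnorm2_tendsto_zero[OF Q])
  have "(\<lambda>t. wnorm2 (mR g i) (snd (zs t i) 0 - vst g i)) \<longlonglongrightarrow> 0" for i
  proof (rule tendsto_sandwich[OF _ _ tendsto_const drop])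
    have "wnorm2 (mR g i) (snd (zs t i) 0 - vst g i) \<le> V g (zs t) - V g (zs (Suc t))" for t
      using l_le[of i t] wnorm2_nonneg[OF Q, of i "fst (zs t i) 0 - sst g i"] by (simp add: lp_def)
    then show "\<forall>\<^sub>F t in sequentially. wnorm2 (mR g i) (snd (zs t i) 0 - vst g i)
        \<le> V g (zs t) - V g (zs (Suc t))"
      by simp
  qed (simp add: wnorm2_nonneg[OF R])
  then have v_lim: "(\<lambda>t. norm (snd (zs t i) 0 - vst g i)) \<longlonglongrightarrow> 0" for i
    by (rule wnorm2_tendsto_zero[OF R])

  have dist: "infdist (x t i) ({sst g i} + Zinf g i) \<le> norm (fst (zs t i) 0 - sst g i)" for t i
  proof -
    have "x t i - fst (zs t i) 0 \<in> Zinf g i"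
      using vg[of t] unfolding rhg_vgne_def feasible_def by auto
    \<comment> \<open>The steady state translated by the current error lies in the target set and
      differs from \<open>x t i\<close> by exactly the nominal deviation.\<close>
    then have "sst g i + (x t i - fst (zs t i) 0) \<in> {sst g i} + Zinf g i"
      by (intro set_plus_intro) auto
    then have "infdist (x t i) ({sst g i} + Zinf g i)
        \<le> dist (x t i) (sst g i + (x t i - fst (zs t i) 0))"
      by (rule infdist_le)
    then show ?thesis by (simp add: dist_norm)
  qed
  have "(\<lambda>t. infdist (x t i) ({sst g i} + Zinf g i)) \<longlonglongrightarrow> 0" for i
    by (rule tendsto_sandwich[OF _ _ tendsto_const s_lim[of i]])
      (auto simp: infdist_nonneg dist)
  then show ?thesis
    using decrease s_lim v_lim dist by blast
qed

end
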